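(* Let $q\in(0,1)$ and $0<p<\tfrac12$ be fixed with $p<q$, and consider the recruiting game $G_k(x_1,x_2)$ with the fixed-probability competition function with parameter $p$. Then the performance ratio of $G_k(x_1,x_2)$ is at least $1-\Theta\!\left(\frac{\log k}{k}\right)$; that is, there is a constant $C=C(p,q)>0$ such that for all integers $k\ge 2$ and all integers $x_1,x_2$ the performance ratio of $G_k(x_1,x_2)$ is at least $1-C\,\frac{\log k}{k}$.
   Context: Recruiting game with fixed-probability competition. For an integer $k\ge1$, a real $q\in(0,1)$, and integers $x_1,x_2$, the game $G_k(x_1,x_2)$ is played by two players over $k$ rounds; player $i$ has initial reputation $x_i$. In each round there are two candidates, the stronger one of quality $1$ and the weaker one of quality $q$. At any point the higher player is the one with larger current reputation (player 1 in case of equality) and the other is the lower player. Knowing the outcomes of all previous rounds, the players simultaneously each choose one candidate to make an offer to. If they choose different candidates, each player hires the candidate it chose. If they choose the same candidate, the lower player hires it with probability $p$ and the higher player hires it with probability $1-p$; the player who loses hires no one in that round. A player's payoff in a round is the quality of the candidate it hires ($0$ if none). Its reputation increases by $1$ if it hired the stronger candidate and is unchanged otherwise. A player's utility is its total expected payoff over the $k$ rounds. Canonical strategies. The strategies $s_k(x_1,x_2)$ are defined by backward induction: in every round the higher player makes an offer to the stronger candidate, and the lower player chooses the candidate maximizing its own expected total utility from the current and all later rounds, given that the later rounds are played according to these strategies; if indifferent, the lower player chooses the weaker candidate. Let $u(s_k(x_1,x_2))$ be the sum of the two players' expected utilities under these strategies. The maximum possible social welfare is $k(1+q)$, and the performance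 ratio of $G_k(x_1,x_2)$ is $\dfrac{u(s_k(x_1,x_2))}{k(1+q)}$. *)

theory Defs
  imports "HOL-Probability.Probability_Mass_Function"
begin

datatype player = P1 | P2

datatype candidate = Stronger | Weaker

type_synonym reputation = "player \<Rightarrow> int"

type_synonym offers = "player \<Rightarrow> candidate"

text \<open>Who hired whom in one round; \<open>None\<close> means that the player hired no one.\<close>
type_synonym outcome = "player \<Rightarrow> candidate option"

text \<open>
  A pair of pure strategies: the offers made in a round depend on the outcomes of all
  previous rounds, listed with the earliest round first.
\<close>
type_synonym strategies = "outcome list \<Rightarrow> offers"

definition higher :: "reputation \<Rightarrow> player" where
  "higher x = (if x P1 \<ge> x P2 then P1 else P2)"

definition lower :: "reputation \<Rightarrow> player" where
  "lower x = (if x P1 \<ge> x P2 then P2 else P1)"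

text \<open>The Boolean drawn below tells whether the lower player wins the competition.\<close>
definition round_outcome :: "real \<Rightarrow> reputation \<Rightarrow> offers \<Rightarrow> outcome pmf" where
  "round_outcome p x a =
     (if a P1 \<noteq> a P2 then return_pmf (\<lambda>i. Some (a i))
      else map_pmf (\<lambda>b i. if i = (if b then lower x else higher x) then Some (a i) else None)
             (bernoulli_pmf p))"

definition payoff :: "real \<Rightarrow> outcome \<Rightarrow> player \<Rightarrow> real" where
  "payoff q w i = (case w i of None \<Rightarrow> 0 | Some Stronger \<Rightarrow> 1 | Some Weaker \<Rightarrow> q)"

definition update :: "reputation \<Rightarrow> outcome \<Rightarrow> reputation" where
  "update x w = (\<lambda>i. if w i = Some Stronger then x i + 1 else x i)"

text \<open>
  \<open>utility p q k \<sigma> x i\<close> is the total expected payoff of player \<open>i\<close> over \<open>k\<close> rounds that start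
  from reputations \<open>x\<close> and are played according to \<open>\<sigma>\<close>. After a first round with outcome \<open>w\<close>,
  the strategies for the remaining rounds are \<open>\<lambda>h. \<sigma> (w # h)\<close>.
\<close>
primrec utility ::
    "real \<Rightarrow> real \<Rightarrow> nat \<Rightarrow> strategies \<Rightarrow> reputation \<Rightarrow> player \<Rightarrow> real" where
  "utility p q 0 \<sigma> x i = 0"
| "utility p q (Suc n) \<sigma> x i =
     measure_pmf.expectation (round_outcome p x (\<sigma> []))
       (\<lambda>w. payoff q w i + utility p q n (\<lambda>h. \<sigma> (w # h)) (update x w) i)"

text \<open>Offers \<open>a\<close> in the first round and, if its outcome is \<open>w\<close>, play \<open>c w\<close> afterwards.\<close>
definition and_then :: "offers \<Rightarrow> (outcome \<Rightarrow> strategies) \<Rightarrow> strategies" where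
  "and_then a c = (\<lambda>h. case h of [] \<Rightarrow> a | w # h' \<Rightarrow> c w h')"

definition offers_with_lower :: "reputation \<Rightarrow> candidate \<Rightarrow> offers" where
  "offers_with_lower x c = (\<lambda>i. if i = higher x then Stronger else c)"

text \<open>
  The strict inequality implements the rule that an indifferent lower player chooses the
  weaker candidate. With no round left to play the value is irrelevant.
\<close>
primrec canonical :: "real \<Rightarrow> real \<Rightarrow> nat \<Rightarrow> reputation \<Rightarrow> strategies" where
  "canonical p q 0 x = (\<lambda>h i. Weaker)"
| "canonical p q (Suc n) x =
     (let later = (\<lambda>w. canonical p q n (update x w));
          value_of = (\<lambda>c. utility p q (Suc n) (and_then (offers_with_lower x c) later) x (lower x))
      in and_then
           (offers_with_lower x (if value_of Stronger > value_of Weaker then Stronger else Weaker))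
           later)"

definition initial :: "int \<Rightarrow> int \<Rightarrow> reputation" where
  "initial x1 x2 = (\<lambda>i. case i of P1 \<Rightarrow> x1 | P2 \<Rightarrow> x2)"

definition canonical_welfare :: "real \<Rightarrow> real \<Rightarrow> nat \<Rightarrow> int \<Rightarrow> int \<Rightarrow> real" where
  "canonical_welfare p q k x1 x2 =
     (let x = initial x1 x2; \<sigma> = canonical p q k x
      in utility p q k \<sigma> x P1 + utility p q k \<sigma> x P2)"

text \<open>
  The denominator is the maximum possible social welfare: in every round both candidates
  are hired.
\<close>
definition performance_ratio :: "real \<Rightarrow> real \<Rightarrow> nat \<Rightarrow> int \<Rightarrow> int \<Rightarrow> real" where
  "performance_ratio p q k x1 x2 = canonical_welfare p q k x1 x2 / (real k * (1 + q))"

end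

theory Submission imports Defs begin

text \<open>
  Under the canonical strategies a competition costs exactly \<open>q\<close> in welfare, so the expected
  number of competitions has to be \<open>O(ln k)\<close>. Let \<open>r = p / (1 - p) < 1\<close>. As \<open>p < q\<close>, a lower
  player gains by competing only through the chance of overtaking, and the probability that it
  ever climbs \<open>m\<close> levels is at most \<open>r ^ m\<close>; its utility over \<open>n\<close> rounds therefore lies between
  \<open>q n\<close> and \<open>q n + n r ^ (m + 1)\<close>. So it does not compete once \<open>n r ^ m \<le> (q - p) / p\<close>, which
  holds from some level \<open>M = O(ln k)\<close> on. Below \<open>M\<close> each competition raises the level by at least
  \<open>1 - 2 p\<close> on average, and the level never falls in any other round, so at most \<open>M / (1 - 2 p)\<close>
  competitions are expected.
\<close>

section \<open>Reputation gaps as a walk on levels\<close>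

definition bump :: "reputation \<Rightarrow> player \<Rightarrow> reputation" where
  "bump x i = x(i := x i + 1)"

text \<open>
  Since player 1 is the higher player in case of equality, the two signs of \<open>x P1 - x P2\<close> are not
  mirror images of each other; shifting by one for the negative sign makes the game symmetric.
  In particular, a lower player that wins at level 0 becomes the higher player at level 0.
\<close>
definition level :: "reputation \<Rightarrow> nat" where
  "level x = nat (if x P1 \<ge> x P2 then x P1 - x P2 else x P2 - x P1 - 1)"

lemma higher_neq_lower [simp]: "higher x \<noteq> lower x" "lower x \<noteq> higher x"
  by (auto simp: higher_def lower_def)

lemma player_cases: "i = higher x \<or> i = lower x"
  by (cases i) (auto simp: higher_def lower_def)

lemma bump_higher [simp]:
  "higher (bump x (higher x)) = higher x"
  "lower (bump x (higher x)) = lower x"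
  "level (bump x (higher x)) = Suc (level x)"
  by (auto simp: bump_def higher_def lower_def level_def)

lemma bump_lower:
  assumes "level x > 0"
  shows "higher (bump x (lower x)) = higher x"
    and "lower (bump x (lower x)) = lower x"
    and "level (bump x (lower x)) = level x - 1"
  using assms by (auto simp: bump_def higher_def lower_def level_def split: if_splits)

lemma level_bump_lower_0:
  assumes "level x = 0"
  shows "level (bump x (lower x)) = 0"
  using assms by (auto simp: bump_def lower_def level_def split: if_splits)

lemma update_eq_bump: "(\<And>i. w i = Some Stronger \<longleftrightarrow> i = j) \<Longrightarrow> update x w = bump x j"
  by (auto simp: update_def bump_def)

section \<open>One round, and the recursion for utilities under canonical play\<close>

lemma expectation_round_outcome_Weaker:
  fixes f :: "outcome \<Rightarrow> real"
  shows "measure_pmf.expectation (round_outcome p x (offers_with_lower x Weaker)) f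
    = f (\<lambda>i. Some (if i = higher x then Stronger else Weaker))"
proof -
  have "offers_with_lower x Weaker P1 \<noteq> offers_with_lower x Weaker P2"
    by (simp add: offers_with_lower_def higher_def)
  then show ?thesis
    by (simp add: round_outcome_def offers_with_lower_def)
qed

lemma expectation_round_outcome_Stronger:
  fixes f :: "outcome \<Rightarrow> real"
  assumes "0 \<le> p" "p \<le> 1"
  shows "measure_pmf.expectation (round_outcome p x (offers_with_lower x Stronger)) f
    = p * f (\<lambda>i. if i = lower x then Some Stronger else None)
      + (1 - p) * f (\<lambda>i. if i = higher x then Some Stronger else None)"
  using assms by (simp add: round_outcome_def offers_with_lower_def)

locale recruiting_game =
  fixes p q :: real
  assumes q: "0 < q" "q < 1" and p: "0 < p" "p < 1/2" and p_less_q: "p < q"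
begin

definition U :: "nat \<Rightarrow> reputation \<Rightarrow> player \<Rightarrow> real" where
  "U n x i = utility p q n (canonical p q n x) x i"

definition offer_value :: "nat \<Rightarrow> reputation \<Rightarrow> candidate \<Rightarrow> player \<Rightarrow> real" where
  "offer_value n x c i =
     utility p q (Suc n)
       (and_then (offers_with_lower x c) (\<lambda>w. canonical p q n (update x w))) x i"

definition competes :: "nat \<Rightarrow> reputation \<Rightarrow> bool" where
  "competes n x \<longleftrightarrow> offer_value n x Stronger (lower x) > offer_value n x Weaker (lower x)"

lemma U_0 [simp]: "U 0 x i = 0"
  by (simp add: U_def)

lemma U_Suc: "U (Suc n) x i = offer_value n x (if competes n x then Stronger else Weaker) i"
  unfolding U_def offer_value_def competes_def canonical.simps Let_def ..

lemma offer_value_eq: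
  "offer_value n x c i = measure_pmf.expectation (round_outcome p x (offers_with_lower x c))
     (\<lambda>w. payoff q w i + U n (update x w) i)"
  by (simp add: offer_value_def and_then_def U_def)

lemma offer_value_Weaker:
  "offer_value n x Weaker i = (if i = higher x then 1 else q) + U n (bump x (higher x)) i"
proof -
  have "update x (\<lambda>i. Some (if i = higher x then Stronger else Weaker)) = bump x (higher x)"
    by (rule update_eq_bump) simp
  then show ?thesis
    by (simp add: offer_value_eq expectation_round_outcome_Weaker payoff_def)
qed

lemma offer_value_Stronger:
  "offer_value n x Stronger i =
     p * ((if i = lower x then 1 else 0) + U n (bump x (lower x)) i)
     + (1 - p) * ((if i = higher x then 1 else 0) + U n (bump x (higher x)) i)"
proof -
  have "update x (\<lambda>i. if i = j then Some Stronger else None) = bump x j" for j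
    by (rule update_eq_bump) simp
  then show ?thesis
    using p by (simp add: offer_value_eq expectation_round_outcome_Stronger payoff_def)
qed

section \<open>Bounds on the lower player's utility\<close>

lemma U_le: "U n x i \<le> real n"
proof (induction n arbitrary: x i)
  case (Suc n)
  have "p * ((if i = lower x then 1 else 0) + U n (bump x (lower x)) i) \<le> p * (1 + real n)"
    "(1 - p) * ((if i = higher x then 1 else 0) + U n (bump x (higher x)) i) \<le> (1 - p) * (1 + real n)"
    using p Suc.IH by (intro mult_left_mono add_mono; simp)+
  moreover have "p * (1 + real n) + (1 - p) * (1 + real n) = 1 + real n"
    by algebra
  ultimately have "offer_value n x Stronger i \<le> 1 + real n"
    unfolding offer_value_Stronger by linarith
  moreover have "offer_value n x Weaker i \<le> 1 + real n"
    unfolding offer_value_Weaker using q Suc.IH by (auto intro!: add_mono)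
  ultimately show ?case
    by (simp add: U_Suc)
qed simp

text \<open>Conceding every round secures \<open>q\<close> each time, as it leaves the roles
  unchanged, and the canonical choice is at least as good.\<close>

lemma U_lower_ge: "q * real n \<le> U n x (lower x)"
proof (induction n arbitrary: x)
  case (Suc n)
  have "q * real (Suc n) \<le> offer_value n x Weaker (lower x)"
    using Suc.IH[of "bump x (higher x)"] by (simp add: offer_value_Weaker algebra_simps)
  also have "\<dots> \<le> U (Suc n) x (lower x)"
    by (simp add: U_Suc competes_def)
  finally show ?case .
qed simp

definition r :: real where
  "r = p / (1 - p)"

lemma r_pos: "0 < r" and r_less_1: "r < 1"
  using p by (simp_all add: r_def)

text \<open>The function \<open>m \<mapsto> r ^ m\<close> is harmonic for the walk that steps down with probability \<open>p\<close>.\<close>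
lemma r_harmonic: "p * r ^ m + (1 - p) * r ^ (m + 2) = r ^ (m + 1)"
proof -
  have "(1 - p) * r = p"
    using p by (simp add: r_def)
  then have "p * r ^ m + (1 - p) * r ^ (m + 2) = (1 - p) * r * r ^ m + p * r * r ^ m"
    by (simp add: power_add power2_eq_square)
  also have "\<dots> = r ^ (m + 1)"
    by (simp add: algebra_simps)
  finally show ?thesis .
qed

text \<open>Induction on the rounds: after a competition \<open>r_harmonic\<close> averages the two
  neighbouring bounds back to the bound at the current level, and the immediate gain
  \<open>p\<close> is below \<open>q\<close>.\<close>

lemma U_lower_le: "U n x (lower x) \<le> q * real n + real n * r ^ (level x + 1)"
proof (induction n arbitrary: x)
  case (Suc n)
  have up: "U n (bump x (higher x)) (lower x) \<le> q * real n + real n * r ^ (level x + 2)"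
    using Suc.IH[of "bump x (higher x)"] by simp
  have down: "U n (bump x (lower x)) (lower x) \<le> q * real n + real n * r ^ level x"
  proof (cases "level x > 0")
    case True
    with Suc.IH[of "bump x (lower x)"] show ?thesis
      by (simp add: bump_lower)
  next
    \<comment> \<open>A win at level 0 makes this player the higher one, so the induction hypothesis
      says nothing; but here \<open>r ^ level x = 1\<close>, and the trivial bound \<open>n\<close>
      suffices.\<close>
    case False
    have "0 \<le> q * real n"
      using q by simp
    with False U_le[of n "bump x (lower x)" "lower x"] show ?thesis
      by simp
  qed
  have "offer_value n x Weaker (lower x) \<le> q * real (Suc n) + real n * r ^ (level x + 2)"
    using up by (simp add: offer_value_Weaker algebra_simps)
  also have "\<dots> \<le> q * real (Suc n) + real (Suc n) * r ^ (level x + 1)"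
    using r_pos r_less_1 by (intro add_left_mono mult_mono power_decreasing) auto
  finally have W: "offer_value n x Weaker (lower x)
    \<le> q * real (Suc n) + real (Suc n) * r ^ (level x + 1)" .
  have "p * U n (bump x (lower x)) (lower x) + (1 - p) * U n (bump x (higher x)) (lower x)
    \<le> p * (q * real n + real n * r ^ level x) + (1 - p) * (q * real n + real n * r ^ (level x + 2))"
    using up down p by (intro add_mono mult_left_mono) auto
  also have "\<dots> = q * real n + real n * (p * r ^ level x + (1 - p) * r ^ (level x + 2))"
    by algebra
  also have "\<dots> = q * real n + real n * r ^ (level x + 1)"
    by (simp only: r_harmonic)
  finally have "offer_value n x Stronger (lower x)
    \<le> p + (q * real n + real n * r ^ (level x + 1))"
    by (simp add: offer_value_Stronger distrib_left)
  also have "\<dots> \<le> q * real (Suc n) + real (Suc n) * r ^ (level x + 1)"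
    using p_less_q r_pos by (simp add: algebra_simps add_increasing2)
  finally show ?case
    using W by (simp add: U_Suc)
qed simp

text \<open>Competing trades a sure \<open>q\<close> for an expected \<open>p\<close> and, with
  probability \<open>p\<close>, replaces the continuation \<open>?up\<close> by
  \<open>?down\<close>. It pays only if \<open>p * (?down - ?up)\<close> exceeds
  \<open>q - p\<close>.\<close>

lemma not_competes:
  assumes "level x > 0" and "real n * r ^ level x \<le> (q - p) / p"
  shows "\<not> competes n x"
proof -
  let ?up = "U n (bump x (higher x)) (lower x)" and ?down = "U n (bump x (lower x)) (lower x)"
  have "?down \<le> q * real n + real n * r ^ level x"
    using U_lower_le[of n "bump x (lower x)"] assms(1) by (simp add: bump_lower)
  moreover have "q * real n \<le> ?up"
    using U_lower_ge[of n "bump x (higher x)"] by simp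
  ultimately have "?down - ?up \<le> (q - p) / p"
    using assms(2) by linarith
  then have "p * (?down - ?up) \<le> q - p"
    using p by (simp add: pos_le_divide_eq mult.commute)
  then show ?thesis
    by (simp add: competes_def offer_value_Stronger offer_value_Weaker algebra_simps)
qed

section \<open>Welfare and the expected number of competitions\<close>

definition welfare :: "nat \<Rightarrow> reputation \<Rightarrow> real" where
  "welfare n x = U n x P1 + U n x P2"

lemma welfare_eq: "welfare n x = U n x i + U n x j" if "i \<noteq> j"
  using that by (cases i; cases j) (auto simp: welfare_def)

lemma welfare_Suc:
  "welfare (Suc n) x =
     (if competes n x
      then 1 + p * welfare n (bump x (lower x)) + (1 - p) * welfare n (bump x (higher x))
      else 1 + q + welfare n (bump x (higher x)))"
  by (simp add: welfare_eq[OF higher_neq_lower(1)[of x]] U_Suc offer_value_Stronger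
      offer_value_Weaker algebra_simps)

text \<open>Distance to level \<open>M\<close> divided by the drift of a competition. Truncated
  subtraction makes it 0 from \<open>M\<close> on.\<close>

definition competition_bound :: "nat \<Rightarrow> nat \<Rightarrow> real" where
  "competition_bound M m = real (M - m) / (1 - 2 * p)"

text \<open>Equality for \<open>m > 0\<close>. At \<open>m = 0\<close> truncation gives
  \<open>m - 1 = 0\<close>, which matches the walk staying at level 0 and only adds slack.\<close>

lemma competition_bound_step:
  assumes "m < M"
  shows "1 + p * competition_bound M (m - 1) + (1 - p) * competition_bound M (m + 1)
    \<le> competition_bound M m"
proof -
  have "(1 - 2 * p) + p * real (M - (m - 1)) + (1 - p) * real (M - (m + 1)) \<le> real (M - m)"
    using assms p by (cases m) (simp_all add: of_nat_diff Suc_le_eq algebra_simps)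
  then have "((1 - 2 * p) + p * real (M - (m - 1)) + (1 - p) * real (M - (m + 1))) / (1 - 2 * p)
    \<le> real (M - m) / (1 - 2 * p)"
    by (rule divide_right_mono) (use p in simp)
  moreover have "(1 - 2 * p) / (1 - 2 * p) = 1"
    using p by simp
  ultimately show ?thesis
    by (simp only: competition_bound_def add_divide_distrib times_divide_eq_right)
qed

text \<open>The horizon \<open>N\<close> stays fixed while \<open>n\<close> shrinks, so that one
  threshold \<open>M\<close> serves every remaining round of the induction.\<close>

lemma welfare_ge:
  assumes M: "M > 0" "real N * r ^ M \<le> (q - p) / p" and "n \<le> N"
  shows "welfare n x \<ge> real n * (1 + q) - q * competition_bound M (level x)"
  using \<open>n \<le> N\<close>
proof (induction n arbitrary: x)
  case 0
  have "0 \<le> q * competition_bound M (level x)"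
    using p q by (simp add: competition_bound_def)
  then show ?case
    by (simp add: welfare_def)
next
  case (Suc n)
  let ?B = "competition_bound M" and ?m = "level x"
  have up: "real n * (1 + q) - q * ?B (?m + 1) \<le> welfare n (bump x (higher x))"
    using Suc.IH[of "bump x (higher x)"] Suc.prems by simp
  show ?case
  proof (cases "competes n x")
    case False
    have "q * ?B (?m + 1) \<le> q * ?B ?m"
      unfolding competition_bound_def
      using p q by (intro mult_left_mono divide_right_mono) auto
    with up False show ?thesis
      by (simp add: welfare_Suc algebra_simps)
  next
    case True
    have "?m < M"
    proof (rule ccontr)
      assume "\<not> ?m < M"
      then have "real n * r ^ ?m \<le> real N * r ^ M"
        using Suc.prems r_pos r_less_1 by (intro mult_mono power_decreasing) auto
      then show False
        using not_competes[of x n] True M \<open>\<not> ?m < M\<close> by linarith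
    qed
    \<comment> \<open>At level 0 the roles swap and the level stays 0, as truncated subtraction
      says.\<close>
    have "level (bump x (lower x)) = ?m - 1"
      by (cases "?m > 0") (simp_all add: bump_lower level_bump_lower_0)
    then have down: "real n * (1 + q) - q * ?B (?m - 1) \<le> welfare n (bump x (lower x))"
      using Suc.IH[of "bump x (lower x)"] Suc.prems by simp
    have "real (Suc n) * (1 + q) - q * ?B ?m
      \<le> real (Suc n) * (1 + q) - q * (1 + p * ?B (?m - 1) + (1 - p) * ?B (?m + 1))"
      using competition_bound_step[OF \<open>?m < M\<close>] q by (intro diff_left_mono mult_left_mono) auto
    also have "\<dots> = 1 + p * (real n * (1 + q) - q * ?B (?m - 1))
      + (1 - p) * (real n * (1 + q) - q * ?B (?m + 1))"
      by (simp add: algebra_simps)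
    also have "\<dots> \<le> 1 + p * welfare n (bump x (lower x)) + (1 - p) * welfare n (bump x (higher x))"
      using up down p by (intro add_mono mult_left_mono) auto
    finally show ?thesis
      using True by (simp add: welfare_Suc)
  qed
qed

section \<open>A logarithmic threshold and the final estimate\<close>

lemma threshold_exists:
  obtains c where "c > 0"
    and "\<And>k. k \<ge> 2 \<Longrightarrow> \<exists>M>0. real k * r ^ M \<le> (q - p) / p \<and> real M \<le> c * ln (real k)"
proof -
  define d where "d = (q - p) / p"
  define s where "s = - ln r"
  have d: "d > 0"
    using p p_less_q by (simp add: d_def)
  have s: "s > 0"
    using r_pos r_less_1 by (simp add: s_def)
  \<comment> \<open>The bound on \<open>M\<close> below is \<open>ln k / s\<close> plus a constant;
    dividing that constant by \<open>ln 2\<close> lets \<open>ln k\<close> absorb it for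
    \<open>k \<ge> 2\<close>.\<close>
  define c where "c = 1 / s + (\<bar>ln d\<bar> / s + 2) / ln 2"
  have "c > 0"
    using s by (simp add: c_def add_pos_nonneg)
  moreover have "\<exists>M>0. real k * r ^ M \<le> d \<and> real M \<le> c * ln (real k)" if k: "k \<ge> 2" for k :: nat
  proof -
    \<comment> \<open>Taking logarithms, \<open>k * r ^ M \<le> d\<close> means
      \<open>s * M \<ge> ln k - ln d\<close>; the absolute value keeps \<open>t\<close> nonnegative
      even when \<open>d\<close> is large.\<close>
    define t where "t = (ln (real k) + \<bar>ln d\<bar>) / s"
    have t: "t \<ge> 0"
      using k s by (simp add: t_def)
    define M where "M = nat \<lceil>t\<rceil> + 1"
    have "t \<le> real M" and M: "real M \<le> t + 2"
      using t unfolding M_def by linarith+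
    then have "ln (real k) - ln d \<le> s * real M"
      using s by (simp add: t_def pos_divide_le_eq mult.commute)
    moreover have "ln (real k * r ^ M) = ln (real k) - s * real M"
      using k r_pos by (simp add: ln_mult ln_realpow s_def)
    ultimately have "ln (real k * r ^ M) \<le> ln d"
      by linarith
    then have "real k * r ^ M \<le> d"
      using k r_pos d by simp
    moreover have "\<bar>ln d\<bar> / s + 2 \<le> (\<bar>ln d\<bar> / s + 2) / ln 2 * ln (real k)"
    proof -
      have "(\<bar>ln d\<bar> / s + 2) / ln 2 * ln 2 \<le> (\<bar>ln d\<bar> / s + 2) / ln 2 * ln (real k)"
        using k s by (intro mult_left_mono) auto
      then show ?thesis
        by simp
    qed
    then have "real M \<le> c * ln (real k)"
      using M by (simp add: t_def c_def distrib_right add_divide_distrib)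
    moreover have "M > 0"
      by (simp add: M_def)
    ultimately show ?thesis
      by blast
  qed
  ultimately show thesis
    using that unfolding d_def by blast
qed

lemma performance_ratio_eq:
  "performance_ratio p q k x1 x2 = welfare k (initial x1 x2) / (real k * (1 + q))"
  by (simp add: performance_ratio_def canonical_welfare_def welfare_def U_def Let_def)

lemma performance_ratio_ge:
  obtains C where "C > 0"
    and "\<And>k x1 x2. k \<ge> 2 \<Longrightarrow> performance_ratio p q k x1 x2 \<ge> 1 - C * (ln (real k) / real k)"
proof -
  obtain c where c: "c > 0"
    "\<And>k. k \<ge> 2 \<Longrightarrow> \<exists>M>0. real k * r ^ M \<le> (q - p) / p \<and> real M \<le> c * ln (real k)"
    using threshold_exists by metis
  \<comment> \<open>The welfare loss \<open>q * c * ln k / (1 - 2 * p)\<close>, normalised by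
    \<open>1 + q\<close>.\<close>
  define C where "C = q * c / ((1 - 2 * p) * (1 + q))"
  have "C > 0"
    using p q c by (simp add: C_def)
  moreover have "performance_ratio p q k x1 x2 \<ge> 1 - C * (ln (real k) / real k)"
    if k: "k \<ge> 2" for k x1 x2
  proof -
    let ?x = "initial x1 x2"
    obtain M where M: "M > 0" "real k * r ^ M \<le> (q - p) / p" "real M \<le> c * ln (real k)"
      using c k by blast
    have "competition_bound M (level ?x) \<le> c * ln (real k) / (1 - 2 * p)"
      unfolding competition_bound_def using M p by (intro divide_right_mono) auto
    then have "q * competition_bound M (level ?x) \<le> q * (c * ln (real k) / (1 - 2 * p))"
      using q by (intro mult_left_mono) auto
    also have "\<dots> = C * ln (real k) * (1 + q)"
      using p q by (simp add: C_def divide_simps)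
    finally have "real k * (1 + q) - C * ln (real k) * (1 + q) \<le> welfare k ?x"
      using welfare_ge[OF M(1,2) order_refl, of ?x] by linarith
    then have "(real k * (1 + q) - C * ln (real k) * (1 + q)) / (real k * (1 + q))
      \<le> performance_ratio p q k x1 x2"
      unfolding performance_ratio_eq using k q by (intro divide_right_mono) auto
    moreover have "(real k * (1 + q) - C * ln (real k) * (1 + q)) / (real k * (1 + q))
      = 1 - C * (ln (real k) / real k)"
      using k q by (simp add: diff_divide_distrib)
    ultimately show ?thesis
      by simp
  qed
  ultimately show thesis
    using that by blast
qed

end

theorem theoremC4:
  fixes p q :: real
  assumes "0 < q" and "q < 1" and "0 < p" and "p < 1/2" and "p < q"
  shows "\<exists>C>0. \<forall>k\<ge>2. \<forall>x1 x2 :: int.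
           performance_ratio p q k x1 x2 \<ge> 1 - C * (ln (real k) / real k)"
proof -
  interpret recruiting_game p q
    using assms by unfold_locales
  obtain C where "C > 0"
    "\<And>k x1 x2. k \<ge> 2 \<Longrightarrow> performance_ratio p q k x1 x2 \<ge> 1 - C * (ln (real k) / real k)"
    by (rule performance_ratio_ge) (rule that)
  then show ?thesis
    by blast
qed

end
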